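(* Let $\alpha$ be an umbra and let $\kappa_\alpha$ be the cumulant umbra of $\alpha$. Then $$\alpha\equiv\beta.\kappa_\alpha,$$ where $\beta$ is the Bell umbra.
   Context: Umbral calculus: $R$ is a commutative integral domain whose quotient field has characteristic zero; $A$ is a set (alphabet) whose elements are called umbrae; $E:R[A]\to R$ is a linear functional (evaluation) with $E[1]=1$ and $E[\alpha^i\gamma^j\cdots\delta^k]=E[\alpha^i]E[\gamma^j]\cdots E[\delta^k]$ for distinct umbrae and nonnegative integers $i,j,\dots,k$. The moments of $\alpha$ are $a_n=E[\alpha^n]$; its generating function (g.f.) is the formal power series $f(t)=1+\sum_{n\ge1}a_n t^n/n!$. Two umbrae are similar, $\alpha\equiv\gamma$, if $E[\alpha^n]=E[\gamma^n]$ for all $n\ge0$, i.e. if they have the same g.f. The alphabet is assumed saturated, i.e. it contains sufficiently many distinct umbrae similar to any expression considered, so that the auxiliary umbrae below exist as umbrae; they are defined up to similarity by their g.f. Dot-product: if $\alpha$ has g.f. $f(t)$ and $\gamma$ has g.f. $g(t)$, then $\gamma.\alpha$ is an auxiliary umbra with g.f. $g[\log f(t)]$. Bell umbra $\beta$: the umbra with $E[\beta(\beta-1)\cdots(\beta-n+1)]=1$ for all $n\ge0$; its g.f. is $\exp(e^t-1)$. Singleton umbra $\chi$: $E[\chi^n]=\delta_{1,n}$ for $n\ge1$; its g.f. is $1+t$. Cumulant umbra: the cumulant of an umbra $\alpha$ is the umbra $\kappa_\alpha$ defined by $\kappa_\alpha\equiv\chi.\alpha$. *)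

theory Defs
  imports
    "HOL-Computational_Algebra.Computational_Algebra"
    "HOL-Library.Poly_Mapping"
begin

(* The alphabet A is the type 'u, the ring R is the type 'r (a commutative domain of
   characteristic zero), and R[A] is the monoid algebra over the free commutative monoid on 'u,
   i.e. the finitely supported maps from exponent vectors to coefficients. *)
type_synonym ('u, 'r) umbral_poly = "('u \<Rightarrow>\<^sub>0 nat) \<Rightarrow>\<^sub>0 'r"

definition umbra :: "'u \<Rightarrow> ('u, 'r::comm_ring_1) umbral_poly" where
  "umbra \<alpha> = Poly_Mapping.single (Poly_Mapping.single \<alpha> 1) 1"

definition scalar :: "'r::comm_ring_1 \<Rightarrow> ('u, 'r) umbral_poly" where
  "scalar c = Poly_Mapping.single 0 c"

instance fract :: ("{idom, ring_char_0}") field_char_0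
proof
  have "(of_nat n :: 'a fract) = to_fract (of_nat n)" for n
    by (induction n) simp_all
  then show "inj (of_nat :: nat \<Rightarrow> 'a fract)"
    by (simp add: inj_on_def)
qed

locale umbral_evaluation =
  fixes E :: "('u, 'r::{idom, ring_char_0}) umbral_poly \<Rightarrow> 'r"
  assumes E_add: "E (p + q) = E p + E q"
    and E_scalar_mult: "E (scalar c * p) = c * E p"
    and E_one: "E 1 = 1"
    and E_uncorrelated:
      "finite S \<Longrightarrow> E (\<Prod>\<alpha>\<in>S. umbra \<alpha> ^ e \<alpha>) = (\<Prod>\<alpha>\<in>S. E (umbra \<alpha> ^ e \<alpha>))"

definition moment :: "(('u, 'r::comm_ring_1) umbral_poly \<Rightarrow> 'r) \<Rightarrow> 'u \<Rightarrow> nat \<Rightarrow> 'r" where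
  "moment E \<alpha> n = E (umbra \<alpha> ^ n)"

definition similar :: "(('u, 'r::comm_ring_1) umbral_poly \<Rightarrow> 'r) \<Rightarrow> 'u \<Rightarrow> 'u \<Rightarrow> bool" where
  "similar E \<alpha> \<gamma> \<longleftrightarrow> (\<forall>n. moment E \<alpha> n = moment E \<gamma> n)"

(* Because of the factorials the generating function has coefficients in the quotient field. *)
definition gen_fun ::
    "(('u, 'r::{idom, ring_char_0}) umbral_poly \<Rightarrow> 'r) \<Rightarrow> 'u \<Rightarrow> 'r fract fps" where
  "gen_fun E \<alpha> = Abs_fps (\<lambda>n. to_fract (moment E \<alpha> n) / fact n)"

(* fps_ln 1 is the series log (1 + t), so this is the formal logarithm of a series with
   constant term 1. *)
definition fps_log :: "'a::field_char_0 fps \<Rightarrow> 'a fps" where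
  "fps_log f = fps_ln 1 oo (f - 1)"

definition is_dot_product ::
    "(('u, 'r::{idom, ring_char_0}) umbral_poly \<Rightarrow> 'r) \<Rightarrow> 'u \<Rightarrow> 'u \<Rightarrow> 'u \<Rightarrow> bool" where
  "is_dot_product E \<gamma> \<alpha> \<delta> \<longleftrightarrow> gen_fun E \<delta> = gen_fun E \<gamma> oo fps_log (gen_fun E \<alpha>)"

(* The dot product is determined only up to similarity; the choice is immaterial, and it is a
   genuine dot product whenever the alphabet is saturated (see dot_product_spec below). *)
definition dot_product ::
    "(('u, 'r::{idom, ring_char_0}) umbral_poly \<Rightarrow> 'r) \<Rightarrow> 'u \<Rightarrow> 'u \<Rightarrow> 'u" where
  "dot_product E \<gamma> \<alpha> = (SOME \<delta>. is_dot_product E \<gamma> \<alpha> \<delta>)"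

definition is_bell_umbra :: "(('u, 'r::comm_ring_1) umbral_poly \<Rightarrow> 'r) \<Rightarrow> 'u \<Rightarrow> bool" where
  "is_bell_umbra E \<beta> \<longleftrightarrow> (\<forall>n. E (\<Prod>i<n. umbra \<beta> - of_nat i) = 1)"

definition is_singleton_umbra :: "(('u, 'r::comm_ring_1) umbral_poly \<Rightarrow> 'r) \<Rightarrow> 'u \<Rightarrow> bool" where
  "is_singleton_umbra E \<chi> \<longleftrightarrow> (\<forall>n\<ge>1. moment E \<chi> n = (if n = 1 then 1 else 0))"

definition is_cumulant_umbra ::
    "(('u, 'r::{idom, ring_char_0}) umbral_poly \<Rightarrow> 'r) \<Rightarrow> 'u \<Rightarrow> 'u \<Rightarrow> bool" where
  "is_cumulant_umbra E \<alpha> \<kappa> \<longleftrightarrow>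
     (\<exists>\<chi>. is_singleton_umbra E \<chi> \<and> similar E \<kappa> (dot_product E \<chi> \<alpha>))"

(* Saturation: the auxiliary umbrae are represented in the alphabet, by infinitely many
   distinct letters. This asks only for Bell umbrae, singleton umbrae and dot products, all of
   which have moments in 'r, not merely in its quotient field. *)
locale saturated_umbral_calculus = umbral_evaluation E
  for E :: "('u, 'r::{idom, ring_char_0}) umbral_poly \<Rightarrow> 'r" +
  assumes saturated_bell: "infinite {\<beta>. is_bell_umbra E \<beta>}"
    and saturated_singleton: "infinite {\<chi>. is_singleton_umbra E \<chi>}"
    and saturated_dot: "infinite {\<delta>. is_dot_product E \<gamma> \<alpha> \<delta>}"

lemma (in saturated_umbral_calculus) dot_product_spec:
  "gen_fun E (dot_product E \<gamma> \<alpha>) = gen_fun E \<gamma> oo fps_log (gen_fun E \<alpha>)"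
proof -
  have "\<exists>\<delta>. is_dot_product E \<gamma> \<alpha> \<delta>"
    using saturated_dot[of \<gamma> \<alpha>] not_finite_existsD by auto
  then have "is_dot_product E \<gamma> \<alpha> (dot_product E \<gamma> \<alpha>)"
    unfolding dot_product_def by (rule someI_ex)
  then show ?thesis
    by (simp add: is_dot_product_def)
qed

lemma similar_iff_gen_fun: "similar E \<alpha> \<gamma> \<longleftrightarrow> gen_fun E \<alpha> = gen_fun E \<gamma>"
  by (simp add: similar_def gen_fun_def fps_eq_iff)

end

(*
  Composition with the exponential inverts the formal logarithm, so everything reduces to the
  generating function g of the Bell umbra. The falling factorials satisfy
  x (x - 1)_n = (x)_(n+1), and E maps all of them to 1; hence E[x q(x - 1)] = E[q(x)] on the
  powers of the Bell umbra x. For q(x) = x^m this reads e^(-t) g' = g, and therefore g(log (1 + t))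
  satisfies h' = h, i.e. it is e^t. The cumulant umbra has generating function 1 + log f, and
  g(log (1 + log f)) = exp (log f) = f.
*)
theory Submission
  imports Defs
begin

text \<open>\<open>fps_ln 1\<close> is the compositional inverse of \<open>fps_exp 1 - 1\<close>,
  whose constant term is 0 and linear coefficient 1.\<close>

lemma fps_exp_compose_ln: "fps_exp 1 oo fps_ln 1 = 1 + (fps_X :: 'a::field_char_0 fps)"
proof -
  have "(fps_exp 1 - 1) oo fps_ln 1 = (fps_X :: 'a fps)"
    unfolding fps_ln_fps_exp_inv[OF one_neq_zero] by (rule fps_inv_right) simp_all
  then show ?thesis
    by (simp add: fps_compose_sub_distrib algebra_simps)
qed

lemma fps_log_nth_0 [simp]: "fps_log f $ 0 = 0"
  by (simp add: fps_log_def)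

lemma fps_exp_compose_log:
  assumes "f $ 0 = 1"
  shows "fps_exp 1 oo fps_log f = f"
proof -
  have f0: "(f - 1) $ 0 = 0"
    using assms by simp
  have "fps_exp 1 oo fps_log f = (fps_exp 1 oo fps_ln 1) oo (f - 1)"
    unfolding fps_log_def by (rule fps_compose_assoc) (use f0 in simp_all)
  also have "\<dots> = f"
    using f0 by (simp add: fps_exp_compose_ln fps_compose_add_distrib fps_X_fps_compose_startby0)
  finally show ?thesis .
qed

text \<open>By the chain rule, substitution turns the factor \<open>fps_exp 1\<close> into
  \<open>1 + fps_X\<close>, which cancels the derivative of \<open>fps_ln 1\<close>.\<close>

lemma fps_ODE_compose_ln:
  fixes g :: "'a::field_char_0 fps"
  assumes "fps_deriv g = fps_exp 1 * g" and "g $ 0 = 1"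
  shows "g oo fps_ln 1 = fps_exp 1"
proof -
  have "fps_deriv (g oo fps_ln 1) = ((fps_exp 1 * g) oo fps_ln 1) * inverse (1 + fps_X)"
    by (simp add: fps_compose_deriv fps_ln_deriv assms(1))
  also have "\<dots> = ((1 + fps_X) * inverse (1 + fps_X)) * (g oo fps_ln 1)"
    by (simp only: fps_compose_mult_distrib[OF fps_ln_0] fps_exp_compose_ln mult_ac)
  also have "(1 + fps_X) * inverse (1 + fps_X) = (1 :: 'a fps)"
    by (rule inverse_mult_eq_1') simp
  finally have "fps_deriv (g oo fps_ln 1) = fps_const 1 * (g oo fps_ln 1)"
    by simp
  \<comment> \<open>A solution of h' = h is fixed by its constant term, here
    \<open>g $ 0\<close>.\<close>
  then have "g oo fps_ln 1 = fps_const ((g oo fps_ln 1) $ 0) * fps_exp 1"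
    by (simp only: fps_exp_unique_ODE)
  then show ?thesis
    using assms(2) by simp
qed

lemma to_fract_of_nat [simp]: "to_fract (of_nat n) = of_nat n"
  by (induction n) simp_all

lemma to_fract_power [simp]: "to_fract (x ^ n) = to_fract x ^ n"
  by (induction n) simp_all

context umbral_evaluation
begin

lemma E_zero: "E 0 = 0"
  using E_add[of 0 0] by simp

lemma E_minus: "E (- p) = - E p"
  using E_add[of p "- p"] by (simp add: E_zero add_eq_0_iff)

lemma E_sum: "E (sum f A) = (\<Sum>i\<in>A. E (f i))"
  by (induction A rule: infinite_finite_induct) (simp_all add: E_zero E_add)

lemma E_of_nat_mult: "E (of_nat n * p) = of_nat n * E p"
  by (induction n) (simp_all add: E_zero E_add algebra_simps)

lemma E_minus_one_power_mult: "E ((- 1) ^ n * p) = (- 1) ^ n * E p"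
  by (induction n) (simp_all add: E_minus)

lemma moment_0 [simp]: "moment E \<alpha> 0 = 1"
  by (simp add: moment_def E_one)

lemma gen_fun_nth_0 [simp]: "gen_fun E \<alpha> $ 0 = 1"
  by (simp add: gen_fun_def)

lemma gen_fun_singleton:
  assumes "is_singleton_umbra E \<chi>"
  shows "gen_fun E \<chi> = 1 + fps_X"
proof (rule fps_ext)
  fix n
  show "gen_fun E \<chi> $ n = (1 + fps_X) $ n"
    \<comment> \<open>The singleton condition starts at n = 1; the coefficient at 0 comes from
      \<open>E_one\<close>.\<close>
    using assms by (cases "n = 0") (auto simp: is_singleton_umbra_def gen_fun_def)
qed

text \<open>Only k = 0 is used later. The general k carries the induction on m, since absorbing one
  linear factor raises the degree of the falling factorial.\<close>

lemma bell_shift: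
  assumes "is_bell_umbra E \<beta>"
  shows "E ((umbra \<beta> - 1) ^ m * (\<Prod>i<Suc k. umbra \<beta> - of_nat i))
    = E (umbra \<beta> ^ m * (\<Prod>i<k. umbra \<beta> - of_nat i))"
proof (induction m arbitrary: k)
  case 0
  then show ?case
    using assms by (simp add: is_bell_umbra_def del: prod.lessThan_Suc)
next
  case (Suc m)
  define x where "x = (umbra \<beta> :: ('u, 'r) umbral_poly)"
  define F where "F = (\<lambda>k. \<Prod>i<k. x - of_nat i)"
  have F_Suc: "F (Suc j) = F j * (x - of_nat j)" for j
    by (simp add: F_def)
  have IH: "E ((x - 1) ^ m * F (Suc j)) = E (x ^ m * F j)" for j
    using Suc.IH by (simp only: x_def F_def)
  \<comment> \<open>Split x - 1 = (x - (k + 1)) + k; the first part extends the falling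
    factorial.\<close>
  have "(x - 1) ^ Suc m * F (Suc k)
      = (x - 1) ^ m * F (Suc (Suc k)) + of_nat k * ((x - 1) ^ m * F (Suc k))"
    by (simp add: F_Suc[of "Suc k"] algebra_simps)
  then have "E ((x - 1) ^ Suc m * F (Suc k)) = E (x ^ m * F (Suc k)) + of_nat k * E (x ^ m * F k)"
    by (simp only: E_add E_of_nat_mult IH)
  also have "\<dots> = E (x ^ m * F (Suc k) + of_nat k * (x ^ m * F k))"
    by (simp only: E_add E_of_nat_mult)
  \<comment> \<open>The matching split is x = (x - k) + k, with the same coefficient k.\<close>
  also have "x ^ m * F (Suc k) + of_nat k * (x ^ m * F k) = x ^ Suc m * F k"
    by (simp add: F_Suc algebra_simps)
  finally show ?case
    by (simp only: x_def F_def)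
qed

text \<open>This is the binomial expansion of E[x (x - 1)^m] = E[x^m] for the Bell umbra x.\<close>

lemma bell_moment_recurrence:
  assumes "is_bell_umbra E \<beta>"
  shows "(\<Sum>k\<le>m. of_nat (m choose k) * ((- 1) ^ (m - k) * moment E \<beta> (Suc k))) = moment E \<beta> m"
proof -
  have "moment E \<beta> m = E ((umbra \<beta> + - 1) ^ m * umbra \<beta>)"
    using bell_shift[OF assms, of m 0] by (simp add: moment_def)
  also have "(umbra \<beta> + - 1) ^ m * umbra \<beta>
      = (\<Sum>k\<le>m. of_nat (m choose k) * ((- 1) ^ (m - k) * umbra \<beta> ^ Suc k))"
    unfolding binomial_ring sum_distrib_right by (rule sum.cong) (simp_all add: mult_ac)
  finally show ?thesis
    by (simp only: E_sum E_of_nat_mult E_minus_one_power_mult moment_def)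
qed

lemma gen_fun_bell_ODE:
  assumes "is_bell_umbra E \<beta>"
  shows "fps_deriv (gen_fun E \<beta>) = fps_exp 1 * gen_fun E \<beta>"
proof -
  \<comment> \<open>Coefficient k of the derivative is the moment of index k + 1 over k!, and the
    signs come from \<open>fps_exp (- 1)\<close>, so the moment recurrence divided by m! is this
    identity at coefficient m.\<close>
  have "fps_deriv (gen_fun E \<beta>) * fps_exp (- 1) = gen_fun E \<beta>"
  proof (rule fps_ext)
    fix m
    have "(fps_deriv (gen_fun E \<beta>) * fps_exp (- 1)) $ m
        = (\<Sum>k\<le>m. to_fract (moment E \<beta> (Suc k)) / fact k * ((- 1) ^ (m - k) / fact (m - k)))"
      unfolding fps_mult_nth atLeast0AtMost
      by (rule sum.cong) (simp_all add: gen_fun_def field_simps del: of_nat_Suc)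
    also have "\<dots> = (\<Sum>k\<le>m. of_nat (m choose k) *
        ((- 1) ^ (m - k) * to_fract (moment E \<beta> (Suc k)))) / fact m"
      unfolding sum_divide_distrib
      by (rule sum.cong) (simp_all add: binomial_fact field_simps)
    also have "\<dots> = gen_fun E \<beta> $ m"
      using arg_cong[OF bell_moment_recurrence[OF assms, of m], of to_fract]
      by (simp add: gen_fun_def)
    finally show "(fps_deriv (gen_fun E \<beta>) * fps_exp (- 1)) $ m = gen_fun E \<beta> $ m" .
  qed
  then have "fps_exp 1 * gen_fun E \<beta>
      = fps_deriv (gen_fun E \<beta>) * (fps_exp (- 1) * fps_exp 1)"
    by (simp only: mult_ac)
  also have "fps_exp (- 1) * fps_exp 1 = (1 :: 'r fract fps)"
    using fps_exp_add_mult[of "- 1 :: 'r fract" 1] by simp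
  finally show ?thesis
    by simp
qed

end

theorem theorem4p11:
  fixes E :: "('u, 'r::{idom, ring_char_0}) umbral_poly \<Rightarrow> 'r"
    and \<alpha> \<beta> \<kappa> :: 'u
  assumes "saturated_umbral_calculus E"
    and "is_cumulant_umbra E \<alpha> \<kappa>"
    and "is_bell_umbra E \<beta>"
  shows "similar E \<alpha> (dot_product E \<beta> \<kappa>)"
proof -
  interpret saturated_umbral_calculus E
    by (rule assms(1))
  let ?f = "gen_fun E \<alpha>" and ?g = "gen_fun E \<beta>"
  obtain \<chi> where \<chi>: "is_singleton_umbra E \<chi>" "similar E \<kappa> (dot_product E \<chi> \<alpha>)"
    using assms(2) by (auto simp: is_cumulant_umbra_def)
  have "gen_fun E \<kappa> = 1 + fps_log ?f"
    using \<chi>(2) by (simp add: similar_iff_gen_fun dot_product_spec gen_fun_singleton[OF \<chi>(1)]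
        fps_compose_add_distrib fps_X_fps_compose_startby0)
  \<comment> \<open>\<open>fps_log\<close> subtracts 1 before substituting, which leaves exactly
    \<open>fps_log ?f\<close>.\<close>
  then have "gen_fun E (dot_product E \<beta> \<kappa>) = ?g oo (fps_ln 1 oo fps_log ?f)"
    by (simp add: dot_product_spec fps_log_def)
  \<comment> \<open>Associativity relies on both inner series having constant term 0.\<close>
  also have "\<dots> = (?g oo fps_ln 1) oo fps_log ?f"
    by (rule fps_compose_assoc) simp_all
  also have "\<dots> = fps_exp 1 oo fps_log ?f"
    using fps_ODE_compose_ln[OF gen_fun_bell_ODE[OF assms(3)]] by simp
  also have "\<dots> = ?f"
    by (rule fps_exp_compose_log) simp
  finally show ?thesis
    by (simp add: similar_iff_gen_fun)
qed

end
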